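(* Let $\mathcal M\subseteq\mathcal V$, $u\in\mathcal V$ and $\delta\in(0,1)$. Let $u_{\mathcal M}\in\arg\min_{v\in\mathcal M}\|u-v\|$ and $u_{\mathcal M,n}\in\arg\min_{v\in\mathcal M}\|u-v\|_n$ be any minimizers. Assume that $\operatorname{RIP}_{\{u_{\mathcal M}\}-\mathcal M}(\delta)$ holds. Then $$\|u_{\mathcal M}-u_{\mathcal M,n}\|\le 2\,\frac{1}{\sqrt{1-\delta}}\,\|u-u_{\mathcal M}\|_{w,\infty}.$$ If in addition $\operatorname{RIP}_{\{u-u_{\mathcal M}\}}(\delta)$ is satisfied, then $$\|u_{\mathcal M}-u_{\mathcal M,n}\|\le 2\sqrt{\frac{1+\delta}{1-\delta}}\;\|u-u_{\mathcal M}\|$$ and consequently $$\|u-u_{\mathcal M}\|\le\|u-u_{\mathcal M,n}\|\le\Big(1+2\frac{\sqrt{1+\delta}}{\sqrt{1-\delta}}\Big)\|u-u_{\mathcal M}\|.$$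
   Context: $Y\subseteq\mathbb R^d$ is a Borel set, $\rho$ a probability measure on $Y$, and $\mathcal V$ a Banach space of functions with norm $\|v\|=\big(\int_Y|v|_y^2\,d\rho(y)\big)^{1/2}$, where for each $y\in Y$, $|\cdot|_y$ is a seminorm on $\mathcal V$ and the integral is finite for all $v\in\mathcal V$. A weight function $w\ge0$ on $Y$ with $\int_Y w^{-1}\,d\rho=1$ is fixed, and $y_1,\dots,y_n\in Y$ is a given (fixed) set of sample points. Put $\|v\|_n:=\big(\frac1n\sum_{i=1}^n w(y_i)|v|_{y_i}^2\big)^{1/2}$ and $\|v\|_{w,\infty}^2:=\operatorname{ess\,sup}_{y\in Y}w(y)|v|_y^2$ (with respect to $\rho$; the value $\infty$ is allowed). Standing convention: the sample points are such that $\|v\|_n\le\|v\|_{w,\infty}$ for all $v\in\mathcal V$. For $A\subseteq\mathcal V$, $\operatorname{RIP}_A(\delta)$ is the statement $(1-\delta)\|v\|^2\le\|v\|_n^2\le(1+\delta)\|v\|^2$ for all $v\in A$. Here $\{u_{\mathcal M}\}-\mathcal M:=\{u_{\mathcal M}-v: v\in\mathcal M\}$. Minimizers $u_{\mathcal M}$ and $u_{\mathcal M,n}$ are assumed to exist but need not be unique. *)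

theory Defs
  imports "HOL-Probability.Essential_Supremum" "HOL-Probability.Probability"
begin

definition seminorm :: "('v::real_vector \<Rightarrow> real) \<Rightarrow> bool" where
  "seminorm p \<longleftrightarrow>
     (\<forall>v. 0 \<le> p v) \<and>
     (\<forall>c v. p (c *\<^sub>R v) = \<bar>c\<bar> * p v) \<and>
     (\<forall>u v. p (u + v) \<le> p u + p v)"

text \<open>
  In the definitions below \<open>s y v\<close> is the value of the seminorm indexed by \<open>y\<close> at \<open>v\<close>,
  and the sample points are \<open>ys 1, \<dots>, ys n\<close>.
\<close>

definition empirical_norm ::
  "('y \<Rightarrow> real) \<Rightarrow> ('y \<Rightarrow> 'v \<Rightarrow> real) \<Rightarrow> nat \<Rightarrow> (nat \<Rightarrow> 'y) \<Rightarrow> 'v \<Rightarrow> real" where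
  "empirical_norm w s n ys v = sqrt (1 / real n * (\<Sum>i=1..n. w (ys i) * (s (ys i) v)\<^sup>2))"

definition ennreal_sqrt :: "ennreal \<Rightarrow> ennreal" where
  "ennreal_sqrt x = (if x = \<infinity> then \<infinity> else ennreal (sqrt (enn2real x)))"

text \<open>
  The constant \<open>esssup\<close> is set to \<open>\<infinity>\<close> on non-measurable functions; this never
  happens when \<open>w\<close> and \<open>\<lambda>y. (s y v)\<^sup>2\<close> are measurable.
\<close>

definition weighted_sup_norm ::
  "'y measure \<Rightarrow> ('y \<Rightarrow> real) \<Rightarrow> ('y \<Rightarrow> 'v \<Rightarrow> real) \<Rightarrow> 'v \<Rightarrow> ennreal" where
  "weighted_sup_norm \<rho> w s v = ennreal_sqrt (esssup \<rho> (\<lambda>y. ennreal (w y * (s y v)\<^sup>2)))"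

definition RIP ::
  "('y \<Rightarrow> real) \<Rightarrow> ('y \<Rightarrow> 'v::real_normed_vector \<Rightarrow> real) \<Rightarrow> nat \<Rightarrow> (nat \<Rightarrow> 'y)
     \<Rightarrow> 'v set \<Rightarrow> real \<Rightarrow> bool" where
  "RIP w s n ys A \<delta> \<longleftrightarrow>
     (\<forall>v\<in>A. (1 - \<delta>) * (norm v)\<^sup>2 \<le> (empirical_norm w s n ys v)\<^sup>2 \<and>
            (empirical_norm w s n ys v)\<^sup>2 \<le> (1 + \<delta>) * (norm v)\<^sup>2)"

end

theory Submission
  imports Defs
begin

text \<open>
  Since \<open>u\<^sub>M\<^sub>n\<close> minimises the empirical distance to \<open>u\<close>, the empirical distance between
  \<open>u\<^sub>M\<close> and \<open>u\<^sub>M\<^sub>n\<close> is at most twice that between \<open>u\<close> and \<open>u\<^sub>M\<close>. The restricted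
  isometry property on the left turns it into a distance in norm; the right-hand side is bounded by
  the weighted supremum norm or, again by restricted isometry, by the norm.
\<close>

lemma seminorm_minus:
  assumes "seminorm p"
  shows "p (- v) = p v"
proof -
  have "p ((-1) *\<^sub>R v) = \<bar>-1\<bar> * p v"
    using assms unfolding seminorm_def by blast
  then show ?thesis by simp
qed

lemma empirical_norm_nonneg:
  assumes "\<And>i. i \<in> {1..n} \<Longrightarrow> 0 \<le> w (ys i)"
  shows "0 \<le> empirical_norm w s n ys v"
  unfolding empirical_norm_def using assms by (auto intro!: divide_nonneg_nonneg mult_nonneg_nonneg sum_nonneg)

lemma empirical_norm_minus:
  assumes "\<And>i. i \<in> {1..n} \<Longrightarrow> seminorm (s (ys i))"
  shows "empirical_norm w s n ys (- v) = empirical_norm w s n ys v"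
  unfolding empirical_norm_def using assms by (simp add: seminorm_minus)

text \<open>Absorbing the factor \<open>w (ys i) / real n\<close> into each coordinate as a square
  root exhibits the empirical norm as a Euclidean norm, so that Minkowski's inequality for
  \<open>L2_set\<close> becomes available. Nonnegative weights ensure that these square roots square
  back to the factors.\<close>

lemma empirical_norm_eq_L2_set:
  assumes "\<And>i. i \<in> {1..n} \<Longrightarrow> 0 \<le> w (ys i)"
  shows "empirical_norm w s n ys v = L2_set (\<lambda>i. sqrt (w (ys i) / real n) * s (ys i) v) {1..n}"
  unfolding empirical_norm_def L2_set_def sum_distrib_left
  using assms by (intro arg_cong[of _ _ sqrt] sum.cong) (simp_all add: power_mult_distrib)

text \<open>Subadditivity of each seminorm gives a coordinatewise bound between nonnegative vectors,
  which \<open>L2_set\<close> preserves; Minkowski's inequality then splits the sum.\<close>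

lemma empirical_norm_triangle:
  assumes w: "\<And>i. i \<in> {1..n} \<Longrightarrow> 0 \<le> w (ys i)"
    and s: "\<And>i. i \<in> {1..n} \<Longrightarrow> seminorm (s (ys i))"
  shows "empirical_norm w s n ys (a + b) \<le> empirical_norm w s n ys a + empirical_norm w s n ys b"
proof -
  let ?c = "\<lambda>i. sqrt (w (ys i) / real n)"
  have "L2_set (\<lambda>i. ?c i * s (ys i) (a + b)) {1..n}
      \<le> L2_set (\<lambda>i. ?c i * s (ys i) a + ?c i * s (ys i) b) {1..n}"
  proof (rule L2_set_mono)
    fix i assume i: "i \<in> {1..n}"
    show "?c i * s (ys i) (a + b) \<le> ?c i * s (ys i) a + ?c i * s (ys i) b"
      unfolding distrib_left[symmetric]
      using w[OF i] s[OF i] by (intro mult_left_mono) (simp_all add: seminorm_def)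
    show "0 \<le> ?c i * s (ys i) (a + b)"
      using w[OF i] s[OF i] by (simp add: seminorm_def)
  qed
  also have "\<dots> \<le> L2_set (\<lambda>i. ?c i * s (ys i) a) {1..n} + L2_set (\<lambda>i. ?c i * s (ys i) b) {1..n}"
    by (rule L2_set_triangle_ineq)
  finally show ?thesis
    by (simp only: empirical_norm_eq_L2_set[of n w ys, OF w])
qed

text \<open>Taking square roots in the lower isometry bound gives the claim;
  \<open>\<delta> < 1\<close> makes the divisor positive.\<close>

lemma RIP_lower:
  assumes "RIP w s n ys A \<delta>" "v \<in> A" "\<delta> < 1" "0 \<le> empirical_norm w s n ys v"
  shows "norm v \<le> empirical_norm w s n ys v / sqrt (1 - \<delta>)"
proof -
  have "sqrt ((1 - \<delta>) * (norm v)\<^sup>2) \<le> sqrt ((empirical_norm w s n ys v)\<^sup>2)"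
    using assms unfolding RIP_def by (intro real_sqrt_le_mono) blast
  then have "sqrt (1 - \<delta>) * norm v \<le> empirical_norm w s n ys v"
    using assms by (simp add: real_sqrt_mult)
  then show ?thesis
    using assms by (simp add: pos_le_divide_eq mult.commute)
qed

lemma RIP_upper:
  assumes "RIP w s n ys A \<delta>" "v \<in> A" "0 \<le> empirical_norm w s n ys v"
  shows "empirical_norm w s n ys v \<le> sqrt (1 + \<delta>) * norm v"
proof -
  have "sqrt ((empirical_norm w s n ys v)\<^sup>2) \<le> sqrt ((1 + \<delta>) * (norm v)\<^sup>2)"
    using assms unfolding RIP_def by (intro real_sqrt_le_mono) blast
  then show ?thesis
    using assms by (simp add: real_sqrt_mult)
qed

theorem theorem2p12:
  fixes Y :: "(real ^ 'd) set"
    and \<rho> :: "(real ^ 'd) measure"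
    and s :: "real ^ 'd \<Rightarrow> 'v::banach \<Rightarrow> real"
    and w :: "real ^ 'd \<Rightarrow> real"
    and n :: nat
    and ys :: "nat \<Rightarrow> real ^ 'd"
    and M :: "'v set"
    and u u\<^sub>M u\<^sub>M\<^sub>n :: 'v
    and \<delta> :: real
  assumes Y_borel: "Y \<in> sets borel"
    and rho_prob: "prob_space \<rho>"
    and rho_sets: "sets \<rho> = sets (restrict_space borel Y)"
    and seminorms: "\<forall>y\<in>Y. seminorm (s y)"
    and integrable: "\<forall>v. integrable \<rho> (\<lambda>y. (s y v)\<^sup>2)"
    and norm_eq: "\<forall>v. norm v = sqrt (\<integral>y. (s y v)\<^sup>2 \<partial>\<rho>)"
    and w_measurable: "w \<in> borel_measurable \<rho>"
    and w_nonneg: "\<forall>y\<in>Y. 0 \<le> w y"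
    and w_integral: "(\<integral>\<^sup>+y. inverse (ennreal (w y)) \<partial>\<rho>) = 1"
    and n_pos: "1 \<le> n"
    and samples: "\<forall>i\<in>{1..n}. ys i \<in> Y"
    and sample_convention:
      "\<forall>v. ennreal (empirical_norm w s n ys v) \<le> weighted_sup_norm \<rho> w s v"
    and delta: "\<delta> \<in> {0<..<1}"
    and uM: "is_arg_min (\<lambda>v. norm (u - v)) (\<lambda>v. v \<in> M) u\<^sub>M"
    and uMn: "is_arg_min (\<lambda>v. empirical_norm w s n ys (u - v)) (\<lambda>v. v \<in> M) u\<^sub>M\<^sub>n"
    and rip: "RIP w s n ys {u\<^sub>M - v | v. v \<in> M} \<delta>"
  shows "ennreal (norm (u\<^sub>M - u\<^sub>M\<^sub>n))
           \<le> ennreal (2 * (1 / sqrt (1 - \<delta>))) * weighted_sup_norm \<rho> w s (u - u\<^sub>M) \<and>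
         (RIP w s n ys {u - u\<^sub>M} \<delta> \<longrightarrow>
           norm (u\<^sub>M - u\<^sub>M\<^sub>n) \<le> 2 * sqrt ((1 + \<delta>) / (1 - \<delta>)) * norm (u - u\<^sub>M) \<and>
           norm (u - u\<^sub>M) \<le> norm (u - u\<^sub>M\<^sub>n) \<and>
           norm (u - u\<^sub>M\<^sub>n) \<le> (1 + 2 * (sqrt (1 + \<delta>) / sqrt (1 - \<delta>))) * norm (u - u\<^sub>M))"
proof -
  define N where "N = empirical_norm w s n ys"
  have w: "0 \<le> w (ys i)" and s: "seminorm (s (ys i))" if "i \<in> {1..n}" for i
    using that samples w_nonneg seminorms by auto
  have N_nonneg: "0 \<le> N v" for v
    unfolding N_def using w by (rule empirical_norm_nonneg)
  have M: "u\<^sub>M \<in> M" "u\<^sub>M\<^sub>n \<in> M"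
    using uM uMn by (auto simp: is_arg_min_def)
  \<comment> \<open>The difference is split through \<open>u\<close>, as
    \<open>- (u - u\<^sub>M) + (u - u\<^sub>M\<^sub>n)\<close>.\<close>
  have "N (u\<^sub>M - u\<^sub>M\<^sub>n) \<le> N (- (u - u\<^sub>M)) + N (u - u\<^sub>M\<^sub>n)"
    using empirical_norm_triangle[of n w ys s "- (u - u\<^sub>M)" "u - u\<^sub>M\<^sub>n", OF w s]
    by (simp add: N_def)
  also have "N (- (u - u\<^sub>M)) = N (u - u\<^sub>M)"
    unfolding N_def using s by (rule empirical_norm_minus)
  \<comment> \<open>\<open>u\<^sub>M\<close> lies in \<open>M\<close>, so it competes with the
    empirical minimizer.\<close>
  also have "N (u - u\<^sub>M\<^sub>n) \<le> N (u - u\<^sub>M)"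
    using uMn M by (auto simp: is_arg_min_linorder N_def)
  finally have "N (u\<^sub>M - u\<^sub>M\<^sub>n) \<le> 2 * N (u - u\<^sub>M)"
    by simp
  \<comment> \<open>Membership of \<open>u\<^sub>M\<^sub>n\<close> in \<open>M\<close> places this
    difference in the set on which \<open>rip\<close> holds.\<close>
  moreover have "norm (u\<^sub>M - u\<^sub>M\<^sub>n) \<le> N (u\<^sub>M - u\<^sub>M\<^sub>n) / sqrt (1 - \<delta>)"
    using RIP_lower[OF rip, of "u\<^sub>M - u\<^sub>M\<^sub>n"] M delta N_nonneg by (auto simp: N_def)
  ultimately have key: "norm (u\<^sub>M - u\<^sub>M\<^sub>n) \<le> 2 * (1 / sqrt (1 - \<delta>)) * N (u - u\<^sub>M)"
    using delta by (simp add: field_simps)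
  \<comment> \<open>The first bound is derived in \<open>ennreal\<close> because the weighted
    supremum norm may be infinite; \<open>sample_convention\<close> then replaces \<open>N\<close>
    by it.\<close>
  have "ennreal (norm (u\<^sub>M - u\<^sub>M\<^sub>n)) \<le> ennreal (2 * (1 / sqrt (1 - \<delta>)) * N (u - u\<^sub>M))"
    using key by (rule ennreal_leI)
  also have "\<dots> = ennreal (2 * (1 / sqrt (1 - \<delta>))) * ennreal (N (u - u\<^sub>M))"
    using delta N_nonneg by (intro ennreal_mult) auto
  also have "\<dots> \<le> ennreal (2 * (1 / sqrt (1 - \<delta>))) * weighted_sup_norm \<rho> w s (u - u\<^sub>M)"
    using sample_convention by (intro mult_left_mono) (simp_all add: N_def)
  finally have sup_bound: "ennreal (norm (u\<^sub>M - u\<^sub>M\<^sub>n))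
      \<le> ennreal (2 * (1 / sqrt (1 - \<delta>))) * weighted_sup_norm \<rho> w s (u - u\<^sub>M)" .
  have best: "norm (u - u\<^sub>M) \<le> norm (u - u\<^sub>M\<^sub>n)"
    using uM M by (auto simp: is_arg_min_linorder)
  \<comment> \<open>Here \<open>N (u - u\<^sub>M)\<close> in \<open>key\<close> is controlled by the
    second isometry assumption instead. The constant is a quotient of roots, as in the last claim;
    \<open>real_sqrt_divide\<close> later matches it with the root of the quotient.\<close>
  have norm_bound: "norm (u\<^sub>M - u\<^sub>M\<^sub>n) \<le> 2 * (sqrt (1 + \<delta>) / sqrt (1 - \<delta>)) * norm (u - u\<^sub>M)"
    if "RIP w s n ys {u - u\<^sub>M} \<delta>"
  proof -
    have "N (u - u\<^sub>M) \<le> sqrt (1 + \<delta>) * norm (u - u\<^sub>M)"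
      using RIP_upper[OF that] N_nonneg by (simp add: N_def)
    then have "2 * (1 / sqrt (1 - \<delta>)) * N (u - u\<^sub>M)
        \<le> 2 * (1 / sqrt (1 - \<delta>)) * (sqrt (1 + \<delta>) * norm (u - u\<^sub>M))"
      using delta by (intro mult_left_mono) auto
    with key show ?thesis by simp
  qed
  \<comment> \<open>The first summand accounts for the 1 in the final constant, the second for the
    multiple of the root quotient.\<close>
  have "norm (u - u\<^sub>M\<^sub>n) \<le> norm (u - u\<^sub>M) + norm (u\<^sub>M - u\<^sub>M\<^sub>n)"
    using norm_triangle_ineq[of "u - u\<^sub>M" "u\<^sub>M - u\<^sub>M\<^sub>n"] by simp
  with sup_bound best norm_bound show ?thesis
    by (fastforce simp: real_sqrt_divide algebra_simps)
qed

end
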